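(* Let $G$ be a connected Lie group with a left invariant pseudo-Riemannian metric $\langle\cdot,\cdot\rangle$ that is Einstein with constant $c\neq0$, i.e. $ric=c\langle\cdot,\cdot\rangle$, and let $\mathfrak g$ be its metric Lie algebra. Then in a direct sum decomposition of $\mathfrak g$ into non-zero, indecomposable, non-degenerate strong ideals (which exists), distinct factors are orthogonal, the factors are unique up to their order, and the restricted metric on each factor is Einstein with the same constant $c$.
   Context: For a connected Lie group $G$ with a left invariant pseudo-Riemannian metric, $\mathfrak g$ is the (finite-dimensional real) Lie algebra of left invariant vector fields with the induced non-degenerate symmetric bilinear form $\langle\cdot,\cdot\rangle$. The Levi-Civita connection gives the bilinear product $\nabla_XY$ on $\mathfrak g$ determined by $2\langle\nabla_XY,Z\rangle=\langle[X,Y],Z\rangle-\langle[Y,Z],X\rangle+\langle[Z,X],Y\rangle$. Curvature: $R(X,Y)Z=\nabla_X\nabla_YZ-\nabla_Y\nabla_XZ-\nabla_{[X,Y]}Z$; Ricci tensor: $ric(X,Y)=\operatorname{tr}\{Z\mapsto R(Z,X)Y\}$. For subspaces, $\nabla_{\mathfrak a}\mathfrak b$ is the linear span of all $\nabla_XY$ with $X\in\mathfrak a$, $Y\in\mathfrak b$. A subspace is non-degenerate if $\langle\cdot,\cdot\rangle$ restricts to a non-degenerate form on it. A subspace $\mathfrak h$ is a strong ideal if $\nabla_{\mathfrak g}\mathfrak h\subseteq\mathfrak h$ and $\nabla_{\mathfrak h}\mathfrak g\subseteq\mathfrak h$ (strong ideals are Lie ideals). A Lie algebra with a non-degenerate symmetric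 bilinear form is decomposable if it is a direct sum of two non-zero, non-degenerate strong ideals, and indecomposable otherwise; a non-degenerate strong ideal is regarded as such an algebra with the restricted bracket and form. *)

theory Defs
  imports Complex_Main "HOL-Library.Multiset"
begin

text \<open>
  A metric Lie algebra is given by a carrier \<open>V\<close>, a subspace of an ambient real vector space
  (of which only \<open>V\<close> matters), a bracket and a form. Everything below is relative to the carrier,
  so that a subspace \<open>H\<close> of \<open>V\<close> closed under the bracket, with the restricted bracket and form, is
  simply the triple with \<open>V\<close> replaced by \<open>H\<close>; its connection and curvature are the intrinsic
  ones of \<open>H\<close>. The metric Lie algebra of left invariant vector fields of a connected Lie group with
  a left invariant pseudo-Riemannian metric is of this kind, and by Lie's third theorem every
  such triple arises in this way.
\<close>

definition bilinear_on :: "'a::real_vector set \<Rightarrow> ('a \<Rightarrow> 'a \<Rightarrow> 'b::real_vector) \<Rightarrow> bool" where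
  "bilinear_on V f \<longleftrightarrow>
     (\<forall>x\<in>V. \<forall>y\<in>V. \<forall>z\<in>V. f (x + y) z = f x z + f y z \<and> f z (x + y) = f z x + f z y) \<and>
     (\<forall>a. \<forall>x\<in>V. \<forall>y\<in>V. f (a *\<^sub>R x) y = a *\<^sub>R f x y \<and> f x (a *\<^sub>R y) = a *\<^sub>R f x y)"

definition lie_algebra_on :: "'a::real_vector set \<Rightarrow> ('a \<Rightarrow> 'a \<Rightarrow> 'a) \<Rightarrow> bool" where
  "lie_algebra_on V br \<longleftrightarrow>
     subspace V \<and> (\<exists>B. finite B \<and> span B = V) \<and>
     (\<forall>x\<in>V. \<forall>y\<in>V. br x y \<in> V) \<and> bilinear_on V br \<and>
     (\<forall>x\<in>V. br x x = 0) \<and>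
     (\<forall>x\<in>V. \<forall>y\<in>V. \<forall>z\<in>V. br x (br y z) + br y (br z x) + br z (br x y) = 0)"

definition nondegenerate_on :: "'a::real_vector set \<Rightarrow> ('a \<Rightarrow> 'a \<Rightarrow> real) \<Rightarrow> bool" where
  "nondegenerate_on V ip \<longleftrightarrow> (\<forall>x\<in>V. (\<forall>y\<in>V. ip x y = 0) \<longrightarrow> x = 0)"

definition metric_lie_algebra ::
  "'a::real_vector set \<Rightarrow> ('a \<Rightarrow> 'a \<Rightarrow> 'a) \<Rightarrow> ('a \<Rightarrow> 'a \<Rightarrow> real) \<Rightarrow> bool" where
  "metric_lie_algebra V br ip \<longleftrightarrow>
     lie_algebra_on V br \<and> bilinear_on V ip \<and>
     (\<forall>x\<in>V. \<forall>y\<in>V. ip x y = ip y x) \<and> nondegenerate_on V ip"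

text \<open>
  The Koszul formula for left invariant fields. The vector exists and is unique because the form
  is non-degenerate on the finite-dimensional carrier.
\<close>
definition levi_civita ::
  "'a::real_vector set \<Rightarrow> ('a \<Rightarrow> 'a \<Rightarrow> 'a) \<Rightarrow> ('a \<Rightarrow> 'a \<Rightarrow> real) \<Rightarrow> 'a \<Rightarrow> 'a \<Rightarrow> 'a" where
  "levi_civita V br ip x y =
     (THE w. w \<in> V \<and>
        (\<forall>z\<in>V. 2 * ip w z = ip (br x y) z - ip (br y z) x + ip (br z x) y))"

definition curvature ::
  "'a::real_vector set \<Rightarrow> ('a \<Rightarrow> 'a \<Rightarrow> 'a) \<Rightarrow> ('a \<Rightarrow> 'a \<Rightarrow> real) \<Rightarrow> 'a \<Rightarrow> 'a \<Rightarrow> 'a \<Rightarrow> 'a" where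
  "curvature V br ip x y z =
     (let D = levi_civita V br ip in D x (D y z) - D y (D x z) - D (br x y) z)"

text \<open>
  The trace of an endomorphism \<open>f\<close> of \<open>V\<close> (finite-dimensional), computed in some basis of \<open>V\<close>; the
  value does not depend on the basis.
\<close>
definition trace_on :: "'a::real_vector set \<Rightarrow> ('a \<Rightarrow> 'a) \<Rightarrow> real" where
  "trace_on V f =
     (let B = (SOME B. independent B \<and> span B = V) in \<Sum>b\<in>B. representation B (f b) b)"

definition ricci ::
  "'a::real_vector set \<Rightarrow> ('a \<Rightarrow> 'a \<Rightarrow> 'a) \<Rightarrow> ('a \<Rightarrow> 'a \<Rightarrow> real) \<Rightarrow> 'a \<Rightarrow> 'a \<Rightarrow> real" where
  "ricci V br ip x y = trace_on V (\<lambda>z. curvature V br ip z x y)"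

definition einstein ::
  "'a::real_vector set \<Rightarrow> ('a \<Rightarrow> 'a \<Rightarrow> 'a) \<Rightarrow> ('a \<Rightarrow> 'a \<Rightarrow> real) \<Rightarrow> real \<Rightarrow> bool" where
  "einstein V br ip c \<longleftrightarrow> (\<forall>x\<in>V. \<forall>y\<in>V. ricci V br ip x y = c * ip x y)"

definition nabla_span ::
  "'a::real_vector set \<Rightarrow> ('a \<Rightarrow> 'a \<Rightarrow> 'a) \<Rightarrow> ('a \<Rightarrow> 'a \<Rightarrow> real) \<Rightarrow> 'a set \<Rightarrow> 'a set \<Rightarrow> 'a set" where
  "nabla_span V br ip S T = span {levi_civita V br ip x y | x y. x \<in> S \<and> y \<in> T}"

definition strong_ideal ::
  "'a::real_vector set \<Rightarrow> ('a \<Rightarrow> 'a \<Rightarrow> 'a) \<Rightarrow> ('a \<Rightarrow> 'a \<Rightarrow> real) \<Rightarrow> 'a set \<Rightarrow> bool" where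
  "strong_ideal V br ip H \<longleftrightarrow>
     subspace H \<and> H \<subseteq> V \<and>
     nabla_span V br ip V H \<subseteq> H \<and> nabla_span V br ip H V \<subseteq> H"

definition direct_sum_list :: "'a::real_vector set \<Rightarrow> 'a set list \<Rightarrow> bool" where
  "direct_sum_list V hs \<longleftrightarrow>
     (\<forall>h\<in>set hs. subspace h) \<and>
     V = {(\<Sum>i<length hs. x i) | x. \<forall>i<length hs. x i \<in> hs ! i} \<and>
     (\<forall>x. (\<forall>i<length hs. x i \<in> hs ! i) \<and> (\<Sum>i<length hs. x i) = 0
          \<longrightarrow> (\<forall>i<length hs. x i = 0))"

text \<open>
  The summands are not required to be mutually orthogonal. A direct sum of strong ideals is
  automatically a direct sum of Lie algebras, strong ideals being Lie ideals.
\<close>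
definition decomposable ::
  "'a::real_vector set \<Rightarrow> ('a \<Rightarrow> 'a \<Rightarrow> 'a) \<Rightarrow> ('a \<Rightarrow> 'a \<Rightarrow> real) \<Rightarrow> bool" where
  "decomposable V br ip \<longleftrightarrow>
     (\<exists>h1 h2. direct_sum_list V [h1, h2] \<and>
        (\<forall>h\<in>{h1, h2}. h \<noteq> {0} \<and> nondegenerate_on h ip \<and> strong_ideal V br ip h))"

definition indecomposable_decomposition ::
  "'a::real_vector set \<Rightarrow> ('a \<Rightarrow> 'a \<Rightarrow> 'a) \<Rightarrow> ('a \<Rightarrow> 'a \<Rightarrow> real) \<Rightarrow> 'a set list \<Rightarrow> bool" where
  "indecomposable_decomposition V br ip hs \<longleftrightarrow>
     direct_sum_list V hs \<and>
     (\<forall>h\<in>set hs. h \<noteq> {0} \<and> nondegenerate_on h ip \<and> strong_ideal V br ip h \<and>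
        \<not> decomposable h br ip)"

end

theory Submission imports Defs begin

text \<open>
  Write \<open>D\<close> for the connection; \<open>D x\<close> is skew, and strong ideals are the two-sided ideals of the
  product \<open>D\<close>. If \<open>D y x = 0\<close> for all \<open>y\<close>, then \<open>R(z, y) x = 0\<close>, so \<open>ric(y, x) = 0\<close> and \<open>x = 0\<close>,
  because \<open>c \<noteq> 0\<close>. By skewness, the products \<open>D x y\<close> therefore span the whole algebra.

  Strong ideals with zero intersection annihilate each other under \<open>D\<close>. Hence, if the algebra is
  the direct sum of strong ideals \<open>h\<close> and \<open>k\<close>, then \<open>h\<close> is spanned by the \<open>D a b\<close> with \<open>a\<close>, \<open>b\<close>
  in \<open>h\<close>, and such a product is orthogonal to \<open>k\<close>. For a second decomposition into \<open>k\<close> and \<open>k'\<close>,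
  splitting \<open>b\<close> gives \<open>h = (h \<inter> k) \<oplus> (h \<inter> k')\<close>, so an indecomposable \<open>h\<close> lies in \<open>k\<close> or in \<open>k'\<close>;
  this yields uniqueness. Finally, for \<open>x\<close>, \<open>y\<close> in \<open>h\<close> the map \<open>z \<mapsto> R(z, x) y\<close> takes values in
  \<open>h\<close>, so its trace is computed in \<open>h\<close>.
\<close>

subsection \<open>Linear algebra on a finite-dimensional carrier\<close>

text \<open>Linearity is required on the carrier only, because \<open>levi_civita\<close>, and with
  it \<open>curvature\<close>, is unspecified off \<open>V\<close>.\<close>

definition linear_map_on :: "'a::real_vector set \<Rightarrow> ('a \<Rightarrow> 'b::real_vector) \<Rightarrow> bool" where
  "linear_map_on V f \<longleftrightarrow>
     (\<forall>x\<in>V. \<forall>y\<in>V. f (x + y) = f x + f y) \<and> (\<forall>a. \<forall>x\<in>V. f (a *\<^sub>R x) = a *\<^sub>R f x)"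

lemma linear_map_on_sum:
  assumes "subspace V" "linear_map_on V f" "\<And>i. i \<in> I \<Longrightarrow> x i \<in> V"
  shows "f (\<Sum>i\<in>I. a i *\<^sub>R x i) = (\<Sum>i\<in>I. a i *\<^sub>R f (x i))"
proof -
  have "f (0 *\<^sub>R 0) = 0 *\<^sub>R f 0"
    using assms unfolding linear_map_on_def by (blast intro: subspace_0)
  then have "f 0 = 0" by simp
  then show ?thesis using assms(3)
  proof (induction I rule: infinite_finite_induct)
    case (insert i I)
    have "(\<Sum>i\<in>I. a i *\<^sub>R x i) \<in> V" "a i *\<^sub>R x i \<in> V"
      using insert assms(1) by (auto intro!: subspace_sum subspace_scale)
    then show ?case
      using insert assms(2) by (simp add: linear_map_on_def)
  qed auto
qed

lemma subspace_finite_basis: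
  fixes V :: "'a::real_vector set"
  assumes "finite B0" "span B0 = V" "subspace H" "H \<subseteq> V"
  obtains B where "independent B" "finite B" "span B = H"
proof -
  obtain B where B: "B \<subseteq> H" "independent B" "H \<subseteq> span B"
    using maximal_independent_subset[of H] by auto
  moreover have "finite B"
    using independent_span_bound[OF assms(1) B(2)] B(1) assms by auto
  moreover have "span B = H"
    using B assms(3) by (simp add: span_minimal subset_antisym)
  ultimately show thesis using that by blast
qed

lemma extend_finite_basis:
  fixes V :: "'a::real_vector set"
  assumes "finite B0" "span B0 = V" "independent S" "S \<subseteq> V"
  obtains B where "S \<subseteq> B" "independent B" "finite B" "span B = V"
proof -
  obtain B where B: "S \<subseteq> B" "B \<subseteq> V" "independent B" "V \<subseteq> span B"
    using maximal_independent_subset_extend[OF assms(4,3)] by auto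
  moreover have "finite B"
    using independent_span_bound[OF assms(1) B(3)] B(2) assms by auto
  moreover have "span B = V"
    using B assms(2) by (metis span_mono span_span subset_antisym)
  ultimately show thesis using that by blast
qed

text \<open>This makes the induction on the dimension decrease when an algebra is split.\<close>

lemma dim_psubset:
  fixes V :: "'a::real_vector set"
  assumes "finite B0" "span B0 = V" "subspace H" "H \<subset> V"
  shows "dim H < dim V"
proof -
  obtain S where S: "independent S" "finite S" "span S = H"
    using subspace_finite_basis[OF assms(1-3)] assms(4) by blast
  moreover from S have "S \<subseteq> V" using assms(4) span_superset by blast
  ultimately obtain B where B: "S \<subseteq> B" "independent B" "finite B" "span B = V"
    using extend_finite_basis[OF assms(1,2)] by blast
  have "S \<subset> B" using B S assms(4) by auto
  then have "card S < card B" using B by (simp add: psubset_card_mono)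
  moreover have "dim H = card S" "dim V = card B"
    using S B by (metis dim_eq_card dim_span)+
  ultimately show ?thesis by simp
qed

section \<open>Coordinates and the trace\<close>

lemma sum_representation:
  fixes B :: "'a::real_vector set"
  assumes "independent B" "finite B" "v \<in> span B"
  shows "(\<Sum>b\<in>B. representation B v b *\<^sub>R b) = v"
  using real_vector.sum_representation_eq[OF assms(1,3,2)] by simp

lemma representation_linear_map_on:
  fixes B :: "'a::real_vector set"
  assumes "independent B"
  shows "linear_map_on (span B) (\<lambda>v. representation B v b)"
  using assms
  by (simp add: linear_map_on_def real_vector.representation_add real_vector.representation_scale)

lemma linear_map_on_comp_representation:
  assumes "independent B" "linear_map_on V f" "\<And>x. x \<in> V \<Longrightarrow> f x \<in> span B"
  shows "linear_map_on V (\<lambda>v. representation B (f v) b)"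
  using assms
  by (simp add: linear_map_on_def real_vector.representation_add real_vector.representation_scale)

text \<open>Both sums are diagonal sums of similar matrices: the first becomes a triple sum over
  base change, matrix of \<open>f\<close> in \<open>C\<close>, and inverse base change, and the two
  base changes cancel.\<close>

lemma trace_basis_independent:
  assumes "independent B" "finite B" "span B = V" "independent C" "finite C" "span C = V"
    and f: "linear_map_on V f" "\<And>x. x \<in> V \<Longrightarrow> f x \<in> V"
  shows "(\<Sum>b\<in>B. representation B (f b) b) = (\<Sum>c\<in>C. representation C (f c) c)"
proof -
  have V: "subspace V" using assms(3) by auto
  have BV: "b \<in> V" if "b \<in> B" for b using that assms(3) span_superset by blast
  have CV: "c \<in> V" if "c \<in> C" for c using that assms(6) span_superset by blast
  have expand: "L x = (\<Sum>b\<in>E. representation E x b * L b)"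
    if "linear_map_on V L" "x \<in> V" "independent E" "finite E" "span E = V"
    for L :: "'a \<Rightarrow> real" and x E
  proof -
    have "L (\<Sum>b\<in>E. representation E x b *\<^sub>R b) = (\<Sum>b\<in>E. representation E x b *\<^sub>R L b)"
      by (rule linear_map_on_sum[OF V that(1)]) (use that(5) span_superset in blast)
    then show ?thesis using sum_representation[of E x] that by simp
  qed
  have LB: "linear_map_on V (\<lambda>v. representation B v b)" for b
    using representation_linear_map_on[OF assms(1)] assms(3) by simp
  have LC: "linear_map_on V (\<lambda>v. representation C v b)" for b
    using representation_linear_map_on[OF assms(4)] assms(6) by simp
  have LBf: "linear_map_on V (\<lambda>v. representation B (f v) b)" for b
    using linear_map_on_comp_representation[OF assms(1) f(1)] f(2) assms(3) by simp
  \<comment> \<open>Expand \<open>b\<close> in \<open>C\<close>, and then each \<open>f c\<close> in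
    \<open>C\<close> again.\<close>
  have "(\<Sum>b\<in>B. representation B (f b) b) =
      (\<Sum>b\<in>B. \<Sum>c\<in>C. \<Sum>c'\<in>C. representation C b c * (representation C (f c) c' * representation B c' b))"
    using expand[OF LBf BV assms(4-6)] expand[OF LB f(2)[OF CV] assms(4-6)]
    by (simp add: sum_distrib_left)
  also have "\<dots> = (\<Sum>c\<in>C. \<Sum>c'\<in>C. \<Sum>b\<in>B. representation C b c * (representation C (f c) c' * representation B c' b))"
    by (subst sum.swap) (rule sum.cong[OF refl], rule sum.swap)
  also have "\<dots> = (\<Sum>c\<in>C. \<Sum>c'\<in>C. representation C (f c) c' * (\<Sum>b\<in>B. representation B c' b * representation C b c))"
    by (simp add: sum_distrib_left mult_ac)
  \<comment> \<open>The inner sum over \<open>B\<close> is the \<open>c\<close>-coordinate of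
    \<open>c'\<close> in \<open>C\<close>, computed through \<open>B\<close>; for basis vectors it
    is a Kronecker delta.\<close>
  also have "\<dots> = (\<Sum>c\<in>C. \<Sum>c'\<in>C. representation C (f c) c' * representation C c' c)"
    using expand[OF LC CV assms(1-3)] by simp
  also have "\<dots> = (\<Sum>c\<in>C. \<Sum>c'\<in>C. if c = c' then representation C (f c) c' else 0)"
    by (intro sum.cong refl) (auto simp: real_vector.representation_basis[OF assms(4)])
  also have "\<dots> = (\<Sum>c\<in>C. representation C (f c) c)"
    using assms(5) by simp
  finally show ?thesis .
qed

text \<open>Removes the choice in \<open>trace_on\<close>. The chosen basis is independent in a
  finitely spanned space, hence finite, and so can be compared with \<open>B\<close>.\<close>

lemma trace_on_eq:
  assumes "independent B" "finite B" "span B = V"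
    and "linear_map_on V f" "\<And>x. x \<in> V \<Longrightarrow> f x \<in> V"
  shows "trace_on V f = (\<Sum>b\<in>B. representation B (f b) b)"
proof -
  define C where "C = (SOME C. independent C \<and> span C = V)"
  have C: "independent C \<and> span C = V"
    unfolding C_def by (rule someI_ex) (use assms in blast)
  then have "C \<subseteq> span B" using assms(3) span_superset by blast
  then have "finite C" using independent_span_bound[OF assms(2)] C by blast
  then show ?thesis
    using trace_basis_independent[of C V B f] C assms
    by (simp add: trace_on_def C_def)
qed

text \<open>
  Since \<open>f\<close> maps into \<open>H\<close>, extending a basis of \<open>H\<close> to one of \<open>V\<close> adds only zero diagonal
  coefficients.
\<close>
lemma trace_on_subspace:
  assumes "finite B0" "span B0 = V" "subspace H" "H \<subseteq> V"
    and f: "linear_map_on V f" "\<And>x. x \<in> V \<Longrightarrow> f x \<in> H"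
    and fg: "\<And>x. x \<in> H \<Longrightarrow> g x = f x"
  shows "trace_on V f = trace_on H g"
proof -
  obtain S where S: "independent S" "finite S" "span S = H"
    using subspace_finite_basis[OF assms(1-4)] by blast
  from S have SV: "S \<subseteq> V" using assms(4) span_superset by blast
  then obtain B where B: "S \<subseteq> B" "independent B" "finite B" "span B = V"
    using extend_finite_basis[OF assms(1,2) S(1)] by blast
  have rep: "representation B (f b) = representation S (f b)" if "b \<in> B" for b
  proof -
    have "b \<in> V" using that B(4) span_superset by blast
    then show ?thesis
      using real_vector.representation_extend[OF B(2) _ B(1)] f(2) S(3) by simp
  qed
  have g: "linear_map_on H g"
    using f(1) assms(3,4) fg by (auto simp: linear_map_on_def subspace_add subspace_scale subsetD)
  have "trace_on V f = (\<Sum>b\<in>B. representation B (f b) b)"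
    using trace_on_eq[OF B(2-4) f(1)] f(2) assms(4) by blast
  also have "\<dots> = (\<Sum>b\<in>B. representation S (f b) b)" using rep by simp
  also have "\<dots> = (\<Sum>b\<in>S. representation S (f b) b)"
    by (rule sum.mono_neutral_right) (use B in \<open>auto dest: real_vector.representation_ne_zero\<close>)
  also have "\<dots> = (\<Sum>b\<in>S. representation S (g b) b)"
    using fg S(3) by (auto intro!: sum.cong simp: span_base)
  also have "\<dots> = trace_on H g"
    using trace_on_eq[OF S g] fg f(2) assms(4) by (metis subsetD)
  finally show ?thesis .
qed

section \<open>Duality for a non-degenerate form\<close>

text \<open>Encode a functional as a vector of \<open>V\<close> whose coefficients are its values on
  a basis. The encoding \<open>T v\<close> of \<open>ip v\<close> is injective in \<open>v\<close>
  by non-degeneracy, so \<open>T\<close> carries a basis to a basis and reaches the encoding of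
  \<phi>.\<close>

lemma nondegenerate_riesz:
  assumes B0: "finite B0" "span B0 = V" and ip: "bilinear_on V ip"
    and nd: "nondegenerate_on V ip" and \<phi>: "linear_map_on V \<phi>"
  obtains w where "w \<in> V" "\<And>z. z \<in> V \<Longrightarrow> ip w z = \<phi> z"
proof -
  have V: "subspace V" using B0 by auto
  obtain B where B: "independent B" "finite B" "span B = V"
    using subspace_finite_basis[OF B0 V] by blast
  then have BV: "b \<in> V" if "b \<in> B" for b using that span_superset by blast
  define T where "T v = (\<Sum>b\<in>B. ip v b *\<^sub>R b)" for v
  have T: "linear_map_on V T"
    using ip BV by (simp add: linear_map_on_def T_def bilinear_on_def scaleR_add_left
        sum.distrib scaleR_sum_right)
  \<comment> \<open>The encoding loses nothing: equal coefficient vectors mean equal functionals on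
    \<open>V\<close>.\<close>
  have coeff: "(\<forall>z\<in>V. \<psi> z = \<chi> z)"
    if "linear_map_on V \<psi>" "linear_map_on V \<chi>" "(\<Sum>b\<in>B. \<psi> b *\<^sub>R b) = (\<Sum>b\<in>B. \<chi> b *\<^sub>R b)"
    for \<psi> \<chi> :: "'a \<Rightarrow> real"
  proof
    fix z assume "z \<in> V"
    have "(\<Sum>b\<in>B. (\<psi> b - \<chi> b) *\<^sub>R b) = 0"
      using that(3) by (simp add: scaleR_diff_left sum_subtractf)
    then have eq: "\<psi> b = \<chi> b" if "b \<in> B" for b
      using independentD[OF B(1,2) subset_refl _ that] by fastforce
    have "\<psi> (\<Sum>b\<in>B. representation B z b *\<^sub>R b) = \<chi> (\<Sum>b\<in>B. representation B z b *\<^sub>R b)"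
      using linear_map_on_sum[OF V that(1), of B "\<lambda>b. b" "representation B z"]
        linear_map_on_sum[OF V that(2), of B "\<lambda>b. b" "representation B z"] BV eq by simp
    then show "\<psi> z = \<chi> z" using sum_representation[OF B(1,2)] B(3) \<open>z \<in> V\<close> by simp
  qed
  have ipl: "linear_map_on V (ip w)" if "w \<in> V" for w
    using ip that by (simp add: linear_map_on_def bilinear_on_def)
  have T0: "v = 0" if "v \<in> V" "T v = 0" for v
  proof -
    have "\<forall>z\<in>V. ip v z = 0"
      using coeff[OF ipl[OF that(1)], of "\<lambda>z. 0"] that(2) by (simp add: T_def linear_map_on_def)
    then show ?thesis using nd that(1) by (simp add: nondegenerate_on_def)
  qed
  have indep: "(\<forall>b\<in>B. u b = 0)" if "(\<Sum>b\<in>B. u b *\<^sub>R T b) = 0" for u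
  proof -
    have "T (\<Sum>b\<in>B. u b *\<^sub>R b) = 0"
      using linear_map_on_sum[OF V T, of B "\<lambda>b. b" u] that BV by simp
    moreover have "(\<Sum>b\<in>B. u b *\<^sub>R b) \<in> V"
      using V BV by (intro subspace_sum subspace_scale)
    ultimately have "(\<Sum>b\<in>B. u b *\<^sub>R b) = 0" using T0 by blast
    then show ?thesis using independentD[OF B(1,2) subset_refl] by blast
  qed
  have inj: "inj_on T B"
  proof
    fix a b assume ab: "a \<in> B" "b \<in> B" "T a = T b"
    have "T (a + (-1) *\<^sub>R b) = T a + (-1) *\<^sub>R T b"
      using T BV ab(1,2) V unfolding linear_map_on_def by (metis subspace_scale)
    then have "a + (-1) *\<^sub>R b = 0"
      using T0[of "a + (-1) *\<^sub>R b"] ab BV V by (simp add: subspace_diff)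
    then show "a = b" by simp
  qed
  have TV: "T ` B \<subseteq> V"
    unfolding T_def using V BV by (auto intro!: subspace_sum subspace_scale)
  have "independent (T ` B)"
  proof
    assume "dependent (T ` B)"
    then obtain u where u: "\<exists>v\<in>T ` B. u v \<noteq> 0" "(\<Sum>v\<in>T ` B. u v *\<^sub>R v) = 0"
      using B(2) by (auto simp: real_vector.dependent_finite)
    then show False
      using indep[of "u \<circ> T"] inj by (auto simp: sum.reindex)
  qed
  then obtain C where C: "T ` B \<subseteq> C" "independent C" "finite C" "span C = V"
    using extend_finite_basis[OF B0 _ TV] by blast
  \<comment> \<open>A basis containing the independent set \<open>T\<close>
    B\<open>has no more elements than\<close>B\<open>, so\<close>T \<open>B\<close> is already a
    basis.\<close>
  have "card C = card (T ` B)"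
    using B C inj by (metis card_image dim_eq_card)
  then have "C = T ` B" using C by (metis card_subset_eq)
  moreover have "(\<Sum>b\<in>B. \<phi> b *\<^sub>R b) \<in> V"
    using V BV by (intro subspace_sum subspace_scale)
  ultimately have "(\<Sum>b\<in>B. \<phi> b *\<^sub>R b) \<in> span (T ` B)" using C by simp
  also have "span (T ` B) = range (\<lambda>u. \<Sum>v\<in>T ` B. u v *\<^sub>R v)"
    using B(2) by (simp add: real_vector.span_finite)
  finally obtain u where u: "(\<Sum>b\<in>B. \<phi> b *\<^sub>R b) = (\<Sum>b\<in>B. u (T b) *\<^sub>R T b)"
    using inj by (auto simp: sum.reindex)
  define w where "w = (\<Sum>b\<in>B. u (T b) *\<^sub>R b)"
  have w: "w \<in> V"
    unfolding w_def using V BV by (intro subspace_sum subspace_scale)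
  have "T w = (\<Sum>b\<in>B. \<phi> b *\<^sub>R b)"
    unfolding w_def u by (rule linear_map_on_sum[OF V T]) (use BV in blast)
  then have "\<forall>z\<in>V. ip w z = \<phi> z"
    using coeff[OF ipl[OF w] \<phi>] by (simp add: T_def)
  then show thesis using that w by blast
qed

text \<open>Extend a basis of \<open>W\<close> together with some \<open>v\<close> outside
  \<open>W\<close> to a basis of \<open>V\<close>. The vector representing the
  \<open>v\<close>-coordinate works: this functional vanishes on \<open>W\<close> and is 1 at
  \<open>v\<close>.\<close>

lemma nondegenerate_orthogonal_vector:
  assumes B0: "finite B0" "span B0 = V" and ip: "bilinear_on V ip"
    and nd: "nondegenerate_on V ip" and W: "subspace W" "W \<subset> V"
  obtains x where "x \<in> V" "x \<noteq> 0" "\<And>w. w \<in> W \<Longrightarrow> ip x w = 0"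
proof -
  obtain S where S: "independent S" "finite S" "span S = W"
    using subspace_finite_basis[OF B0 W(1)] W(2) by blast
  obtain v where v: "v \<in> V" "v \<notin> W" using W by blast
  have SV: "S \<subseteq> W" using S(3) span_superset by blast
  have iv: "independent (insert v S)" using S v SV by (auto simp: independent_insert)
  obtain B where B: "insert v S \<subseteq> B" "independent B" "finite B" "span B = V"
    by (rule extend_finite_basis[OF B0 iv]) (use v SV W in auto)
  have l: "linear_map_on V (\<lambda>z. representation B z v)"
    using representation_linear_map_on[OF B(2)] B(4) by simp
  then obtain x where x: "x \<in> V" "\<And>z. z \<in> V \<Longrightarrow> ip x z = representation B z v"
    using nondegenerate_riesz[OF B0 ip nd l] by blast
  have "ip x v = 1" using x(2)[OF v(1)] B by (simp add: real_vector.representation_basis)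
  moreover have "ip 0 v = 0"
    using ip v(1) B(4) unfolding bilinear_on_def by (metis scale_zero_left span_zero)
  ultimately have "x \<noteq> 0" by auto
  moreover have "ip x w = 0" if "w \<in> W" for w
  proof -
    have "representation B w = representation S w"
      by (rule real_vector.representation_extend) (use B S that in auto)
    moreover have "representation S w v = 0"
      using v SV real_vector.representation_ne_zero by blast
    ultimately show ?thesis using x(2) that W by auto
  qed
  ultimately show thesis using that x(1) by blast
qed

subsection \<open>Strong ideals and direct sums\<close>

text \<open>An index-free form of \<open>direct_sum_list\<close> for two summands;
  \<open>direct_sum_list_pair\<close> shows the equivalence.\<close>

definition complementary :: "'a::real_vector set \<Rightarrow> 'a set \<Rightarrow> 'a set \<Rightarrow> bool" where
  "complementary V h k \<longleftrightarrow> subspace h \<and> subspace k \<and> h \<subseteq> V \<and> k \<subseteq> V \<and>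
     h \<inter> k = {0} \<and> (\<forall>v\<in>V. \<exists>a\<in>h. \<exists>b\<in>k. v = a + b)"

section \<open>The Levi-Civita product of a metric Lie algebra\<close>

locale metric_lie =
  fixes V :: "'a::real_vector set" and br ip
  assumes mla: "metric_lie_algebra V br ip"
begin

abbreviation "D \<equiv> levi_civita V br ip"

lemma sub: "subspace V"
  using mla by (simp add: metric_lie_algebra_def lie_algebra_on_def)

lemma finite_span: obtains B0 where "finite B0" "span B0 = V"
  using mla by (auto simp: metric_lie_algebra_def lie_algebra_on_def)

lemma ip_bilinear: "bilinear_on V ip" and br_bilinear: "bilinear_on V br"
  and nondeg: "nondegenerate_on V ip"
  and ip_sym: "x \<in> V \<Longrightarrow> y \<in> V \<Longrightarrow> ip x y = ip y x"
  and br_in [simp]: "x \<in> V \<Longrightarrow> y \<in> V \<Longrightarrow> br x y \<in> V"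
  using mla by (auto simp: metric_lie_algebra_def lie_algebra_on_def)

lemma in_V [simp]:
  "0 \<in> V" "x \<in> V \<Longrightarrow> y \<in> V \<Longrightarrow> x + y \<in> V" "x \<in> V \<Longrightarrow> y \<in> V \<Longrightarrow> x - y \<in> V"
  "x \<in> V \<Longrightarrow> a *\<^sub>R x \<in> V"
  using sub by (auto simp: subspace_0 subspace_add subspace_diff subspace_scale)

lemma bilinear_add [simp]:
  assumes "x \<in> V" "y \<in> V" "z \<in> V"
  shows "ip (x + y) z = ip x z + ip y z" "ip z (x + y) = ip z x + ip z y"
    "br (x + y) z = br x z + br y z" "br z (x + y) = br z x + br z y"
  using assms ip_bilinear br_bilinear by (simp_all add: bilinear_on_def)

lemma bilinear_scale [simp]:
  assumes "x \<in> V" "y \<in> V"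
  shows "ip (a *\<^sub>R x) y = a * ip x y" "ip x (a *\<^sub>R y) = a * ip x y"
    "br (a *\<^sub>R x) y = a *\<^sub>R br x y" "br x (a *\<^sub>R y) = a *\<^sub>R br x y"
  using assms ip_bilinear br_bilinear by (simp_all add: bilinear_on_def)

lemma ip_0 [simp]: "x \<in> V \<Longrightarrow> ip 0 x = 0" "x \<in> V \<Longrightarrow> ip x 0 = 0"
  using bilinear_scale(1)[of 0 x 0] bilinear_scale(2)[of x 0 0] by auto

lemma ip_diff [simp]:
  assumes "x \<in> V" "y \<in> V" "z \<in> V"
  shows "ip (x - y) z = ip x z - ip y z" "ip z (x - y) = ip z x - ip z y"
  using bilinear_add(1,2)[of "x - y" y z] assms by auto

lemma br_anti:
  assumes "x \<in> V" "y \<in> V" shows "br y x = - br x y"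
proof -
  have "br (x + y) (x + y) = 0" "br x x = 0" "br y y = 0"
    using assms mla by (auto simp: metric_lie_algebra_def lie_algebra_on_def simp del: bilinear_add)
  then show ?thesis using assms by (simp add: add_eq_0_iff)
qed

lemma ip_br_anti: "x \<in> V \<Longrightarrow> y \<in> V \<Longrightarrow> z \<in> V \<Longrightarrow> ip (br y x) z = - ip (br x y) z"
  using ip_diff(1)[of 0 "br x y" z] by (simp add: br_anti[of x y])

lemma ip_eqI:
  assumes "x \<in> V" "y \<in> V" "\<And>z. z \<in> V \<Longrightarrow> ip x z = ip y z" shows "x = y"
  using nondeg[unfolded nondegenerate_on_def, rule_format, of "x - y"] assms by simp

text \<open>Half the right side of the Koszul formula is linear in \<open>z\<close>, hence
  represented by a vector; non-degeneracy makes it unique. This justifies the description operator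
  in \<open>levi_civita\<close>.\<close>

lemma levi_civita_ex1:
  assumes "x \<in> V" "y \<in> V"
  shows "\<exists>!w. w \<in> V \<and> (\<forall>z\<in>V. 2 * ip w z = ip (br x y) z - ip (br y z) x + ip (br z x) y)"
proof -
  obtain B0 where B0: "finite B0" "span B0 = V" by (rule finite_span)
  have "linear_map_on V (\<lambda>z. (ip (br x y) z - ip (br y z) x + ip (br z x) y) / 2)"
    using assms by (simp add: linear_map_on_def field_simps)
  then obtain w where "w \<in> V" "\<And>z. z \<in> V \<Longrightarrow> ip w z = (ip (br x y) z - ip (br y z) x + ip (br z x) y) / 2"
    using nondegenerate_riesz[OF B0 ip_bilinear nondeg] by blast
  note w = this
  show ?thesis
  proof (intro ex1I[of _ w] conjI ballI)
    fix u
    assume u: "u \<in> V \<and> (\<forall>z\<in>V. 2 * ip u z = ip (br x y) z - ip (br y z) x + ip (br z x) y)"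
    show "u = w"
    proof (rule ip_eqI)
      fix z assume "z \<in> V"
      then have "2 * ip u z = ip (br x y) z - ip (br y z) x + ip (br z x) y" using u by blast
      then show "ip u z = ip w z" using w(2)[OF \<open>z \<in> V\<close>] by simp
    qed (use u w in auto)
  qed (use w in \<open>simp_all add: mult.commute\<close>)
qed

lemma D_in [simp]: "x \<in> V \<Longrightarrow> y \<in> V \<Longrightarrow> D x y \<in> V"
  and koszul: "x \<in> V \<Longrightarrow> y \<in> V \<Longrightarrow> z \<in> V \<Longrightarrow>
    2 * ip (D x y) z = ip (br x y) z - ip (br y z) x + ip (br z x) y"
  using theI'[OF levi_civita_ex1[of x y]] unfolding levi_civita_def by blast+

text \<open>Bilinearity of \<open>D\<close> and its compatibility with restriction to an ideal are
  both checked in this form.\<close>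

lemma D_eqI:
  assumes "x \<in> V" "y \<in> V" "w \<in> V"
    "\<And>z. z \<in> V \<Longrightarrow> 2 * ip w z = ip (br x y) z - ip (br y z) x + ip (br z x) y"
  shows "D x y = w"
proof (rule ip_eqI)
  fix z assume "z \<in> V"
  then show "ip (D x y) z = ip w z" using koszul[OF assms(1,2), of z] assms(4)[of z] by simp
qed (use assms in simp_all)

lemma D_add [simp]:
  assumes "x \<in> V" "y \<in> V" "z \<in> V"
  shows "D (x + y) z = D x z + D y z" "D z (x + y) = D z x + D z y"
  by (rule D_eqI; use assms in \<open>simp add: koszul distrib_left\<close>)+

lemma D_scale [simp]:
  assumes "x \<in> V" "y \<in> V"
  shows "D (a *\<^sub>R x) y = a *\<^sub>R D x y" "D x (a *\<^sub>R y) = a *\<^sub>R D x y"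
  by (rule D_eqI; use assms in
      \<open>simp add: koszul mult.left_commute[of 2 a] distrib_left right_diff_distrib\<close>)+

lemma D_0 [simp]: "x \<in> V \<Longrightarrow> D 0 x = 0" "x \<in> V \<Longrightarrow> D x 0 = 0"
  using D_scale(1)[of 0 x 0] D_scale(2)[of x 0 0] by auto

text \<open>Subtract the Koszul formulas for \<open>(x, y, z)\<close> and \<open>(y, x, z)\<close>;
  by antisymmetry only the bracket of \<open>x\<close> and \<open>y\<close> survives.\<close>

lemma torsion_free: "x \<in> V \<Longrightarrow> y \<in> V \<Longrightarrow> br x y = D x y - D y x"
proof (rule ip_eqI)
  fix z assume *: "x \<in> V" "y \<in> V" "z \<in> V"
  then show "ip (br x y) z = ip (D x y - D y x) z"
    using koszul[of x y z] koszul[of y x z] ip_br_anti[of x y z] ip_br_anti[of y z x] ip_br_anti[of z x y]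
    by simp
qed auto

text \<open>The Koszul formulas for \<open>(x, y, z)\<close> and \<open>(x, z, y)\<close> add up to
  zero by antisymmetry of \<open>br\<close>.\<close>

lemma D_skew: "x \<in> V \<Longrightarrow> y \<in> V \<Longrightarrow> z \<in> V \<Longrightarrow> ip (D x y) z = - ip y (D x z)"
  using koszul[of x y z] koszul[of x z y] ip_br_anti[of x y z] ip_br_anti[of y z x]
    ip_br_anti[of z x y] ip_sym[of y "D x z"]
  by simp

section \<open>Strong ideals as two-sided ideals of the product \<open>D\<close>\<close>

lemma strong_ideal_iff:
  "strong_ideal V br ip h \<longleftrightarrow>
     subspace h \<and> h \<subseteq> V \<and> (\<forall>x\<in>V. \<forall>y\<in>h. D x y \<in> h \<and> D y x \<in> h)" (is "?L \<longleftrightarrow> ?R")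
proof
  assume L: ?L
  have "D x y \<in> nabla_span V br ip V h" "D y x \<in> nabla_span V br ip h V" if "x \<in> V" "y \<in> h" for x y
    unfolding nabla_span_def using that by (intro span_base; blast)+
  with L show ?R by (simp add: strong_ideal_def subset_iff)
next
  assume R: ?R
  then have "nabla_span V br ip V h \<subseteq> h" "nabla_span V br ip h V \<subseteq> h"
    unfolding nabla_span_def by (intro span_minimal subsetI; auto)+
  with R show ?L by (simp add: strong_ideal_def)
qed

text \<open>Closure under the bracket comes from \<open>torsion_free\<close>; the identities are
  inherited from \<open>V\<close>.\<close>

lemma strong_ideal_metric_lie:
  assumes "strong_ideal V br ip h" "nondegenerate_on h ip"
  shows "metric_lie h br ip"
proof
  have h: "subspace h" "h \<subseteq> V" "\<And>x y. x \<in> V \<Longrightarrow> y \<in> h \<Longrightarrow> D x y \<in> h \<and> D y x \<in> h"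
    using assms(1) by (auto simp: strong_ideal_iff)
  obtain B where "finite B" "span B = h"
    using finite_span subspace_finite_basis h(1,2) by metis
  moreover have "br x y \<in> h" if "x \<in> h" "y \<in> h" for x y
    using that h torsion_free[of x y] by (metis subsetD subspace_diff)
  moreover have "bilinear_on h br" "bilinear_on h ip"
    using br_bilinear ip_bilinear h(2) unfolding bilinear_on_def by blast+
  ultimately show "metric_lie_algebra h br ip"
    using mla assms(2) h(1,2) unfolding metric_lie_algebra_def lie_algebra_on_def by blast
qed

text \<open>The ambient product lies in \<open>h\<close> and satisfies the Koszul formula against
  all \<open>z\<close> in \<open>h\<close>, which determines the intrinsic product.\<close>

lemma levi_civita_restrict:
  assumes "strong_ideal V br ip h" "nondegenerate_on h ip" "x \<in> h" "y \<in> h"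
  shows "levi_civita h br ip x y = D x y"
proof -
  interpret h: metric_lie h br ip using strong_ideal_metric_lie assms by blast
  have "h \<subseteq> V" "D x y \<in> h" using assms by (auto simp: strong_ideal_iff)
  then show ?thesis using assms by (intro h.D_eqI) (simp_all add: koszul subset_iff)
qed

text \<open>Both ideals are two-sided, so each product lies in the intersection.\<close>

lemma complementary_D_0:
  assumes "h \<inter> k = {0}" "strong_ideal V br ip h" "strong_ideal V br ip k" "x \<in> h" "y \<in> k"
  shows "D x y = 0" "D y x = 0"
  using assms unfolding strong_ideal_iff by blast+

lemma strong_ideal_inter:
  assumes "strong_ideal V br ip h" "strong_ideal V br ip k"
  shows "strong_ideal V br ip (h \<inter> k)"
  using assms unfolding strong_ideal_iff by (auto intro: subspace_inter)

text \<open>Serves to see that all summands but one together span a strong ideal.\<close>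

lemma strong_ideal_span_Union:
  assumes "\<And>h. h \<in> H \<Longrightarrow> strong_ideal V br ip h"
  shows "strong_ideal V br ip (span (\<Union>H))"
  unfolding strong_ideal_iff
proof (intro conjI ballI)
  show *: "span (\<Union>H) \<subseteq> V"
    using assms sub by (intro span_minimal) (auto simp: strong_ideal_iff)
  fix x y assume x: "x \<in> V" and y: "y \<in> span (\<Union>H)"
  have "y \<in> V \<and> D x y \<in> span (\<Union>H) \<and> D y x \<in> span (\<Union>H)"
    using y
  proof (induction rule: span_induct_alt)
    case base then show ?case using x by (simp add: span_zero)
  next
    case (step c u v)
    then obtain h where h: "h \<in> H" "u \<in> h" by blast
    then have u: "u \<in> V" "D x u \<in> h" "D u x \<in> h"
      using assms x unfolding strong_ideal_iff by blast+
    then have "D x u \<in> span (\<Union>H)" "D u x \<in> span (\<Union>H)" using h by (auto intro: span_base)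
    then show ?case using step u x by (simp add: span_add span_scale)
  qed
  then show "D x y \<in> span (\<Union>H)" "D y x \<in> span (\<Union>H)" by auto
qed auto

text \<open>Multiplication by the \<open>k\<close>-part of a vector kills \<open>h\<close>, hence
  \<open>l\<close>, so only products inside \<open>h\<close> remain. This lifts the summands of a
  summand to strong ideals of \<open>V\<close>.\<close>

lemma strong_ideal_trans:
  assumes c: "complementary V h k" and h: "strong_ideal V br ip h" "nondegenerate_on h ip"
    and k: "strong_ideal V br ip k" and l: "strong_ideal h br ip l"
  shows "strong_ideal V br ip l"
proof -
  interpret h: metric_lie h br ip using strong_ideal_metric_lie h by blast
  have l: "subspace l" "l \<subseteq> h" "\<And>x y. x \<in> h \<Longrightarrow> y \<in> l \<Longrightarrow> D x y \<in> l \<and> D y x \<in> l"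
    using l h by (auto simp: h.strong_ideal_iff levi_civita_restrict subset_iff)
  have hk: "h \<subseteq> V" "k \<subseteq> V" "h \<inter> k = {0}" and dec: "\<forall>v\<in>V. \<exists>a\<in>h. \<exists>b\<in>k. v = a + b"
    using c by (simp_all add: complementary_def)
  have "D x y \<in> l \<and> D y x \<in> l" if x: "x \<in> V" and y: "y \<in> l" for x y
  proof -
    obtain a b where ab: "a \<in> h" "b \<in> k" "x = a + b"
      using bspec[OF dec x] by blast
    moreover have "y \<in> h" using y l by blast
    moreover have "D b y = 0" "D y b = 0"
      using complementary_D_0[OF hk(3) h(1) k] ab \<open>y \<in> h\<close> by auto
    ultimately show ?thesis using hk(1,2) l(3)[OF _ y] by (simp add: subset_iff)
  qed
  then show ?thesis using l hk by (auto simp: strong_ideal_iff)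
qed

end

section \<open>Direct sums of lists of subspaces\<close>

lemma complementary_sym: "complementary V h k \<Longrightarrow> complementary V k h"
  unfolding complementary_def by (metis Int_commute add.commute)

lemma direct_sum_list_pair:
  assumes V: "subspace V"
  shows "direct_sum_list V [h, k] \<longleftrightarrow> complementary V h k"
proof
  assume L: "direct_sum_list V [h, k]"
  have s: "subspace h" "subspace k" and
    Veq: "V = {x (0::nat) + x 1 | x. x 0 \<in> h \<and> x 1 \<in> k}" and
    z: "\<And>x::nat \<Rightarrow> 'a. x 0 \<in> h \<Longrightarrow> x 1 \<in> k \<Longrightarrow> x 0 + x 1 = 0 \<Longrightarrow> x 0 = 0 \<and> x 1 = 0"
    using L by (auto simp: direct_sum_list_def numeral_2_eq_2 All_less_Suc2)
  have Vi: "a + b \<in> V" if "a \<in> h" "b \<in> k" for a b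
    unfolding Veq using that by (intro CollectI exI[of _ "\<lambda>i. if i = 0 then a else b"]) auto
  have "h \<inter> k = {0}"
  proof -
    have "a = 0" if "a \<in> h" "a \<in> k" for a
      using z[of "\<lambda>i. if i = 0 then a else - a"] that s by (simp add: subspace_neg)
    then show ?thesis using s by (auto simp: subspace_0)
  qed
  moreover have "h \<subseteq> V" "k \<subseteq> V" using Vi s subspace_0 by (metis add_0_right subsetI, metis add_0_left subsetI)
  moreover have "\<forall>v\<in>V. \<exists>a\<in>h. \<exists>b\<in>k. v = a + b" unfolding Veq by blast
  ultimately show "complementary V h k" using s by (simp add: complementary_def)
next
  assume R: "complementary V h k"
  then have R: "subspace h" "subspace k" "h \<subseteq> V" "k \<subseteq> V" "h \<inter> k = {0}"
    "\<And>v. v \<in> V \<Longrightarrow> \<exists>a\<in>h. \<exists>b\<in>k. v = a + b" by (auto simp: complementary_def)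
  have "v \<in> V \<longleftrightarrow> (\<exists>x::nat \<Rightarrow> 'a. v = x 0 + x 1 \<and> x 0 \<in> h \<and> x 1 \<in> k)" for v
  proof
    assume "v \<in> V"
    then obtain a b where "a \<in> h" "b \<in> k" "v = a + b" using R(6) by blast
    then show "\<exists>x::nat \<Rightarrow> 'a. v = x 0 + x 1 \<and> x 0 \<in> h \<and> x 1 \<in> k"
      by (intro exI[of _ "\<lambda>i. if i = 0 then a else b"]) auto
  qed (use R V in \<open>auto intro: subspace_add\<close>)
  moreover have "a = 0 \<and> b = 0" if "a \<in> h" "b \<in> k" "a + b = 0" for a b
  proof -
    have "a = - b" using that by (simp add: add_eq_0_iff2)
    then have "a \<in> h \<inter> k" using that R(2) by (simp add: subspace_neg)
    then show ?thesis using R(5) that by auto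
  qed
  ultimately show "direct_sum_list V [h, k]"
    using R by (auto simp: direct_sum_list_def numeral_2_eq_2 All_less_Suc2)
qed

text \<open>A family over the concatenation is a family over \<open>hs\<close> followed by one over
  \<open>ks\<close> with indices shifted by \<open>length hs\<close>. If the total is zero, both
  partial sums lie in \<open>h \<inter> k\<close> and vanish separately.\<close>

lemma direct_sum_list_append:
  assumes V: "subspace V" and c: "complementary V h k"
    and hs: "direct_sum_list h hs" and ks: "direct_sum_list k ks"
  shows "direct_sum_list V (hs @ ks)"
proof -
  let ?n = "length hs" and ?m = "length ks"
  have split: "(\<Sum>i<?n + ?m. x i) = (\<Sum>i<?n. x i) + (\<Sum>i<?m. x (?n + i))" for x :: "nat \<Rightarrow> 'a"
    by (induction ks) (simp_all add: add.assoc)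
  have mem: "(\<forall>i<?n + ?m. x i \<in> (hs @ ks) ! i) \<longleftrightarrow> (\<forall>i<?n. x i \<in> hs ! i) \<and> (\<forall>i<?m. x (?n + i) \<in> ks ! i)"
    for x :: "nat \<Rightarrow> 'a"
  proof (intro iffI conjI allI impI)
    fix i assume a: "(\<forall>i<?n. x i \<in> hs ! i) \<and> (\<forall>i<?m. x (?n + i) \<in> ks ! i)" "i < ?n + ?m"
    then have "x (?n + (i - ?n)) \<in> ks ! (i - ?n)" if "\<not> i < ?n" using that
      by (metis add_less_cancel_left le_add_diff_inverse linorder_not_less)
    then show "x i \<in> (hs @ ks) ! i" using a by (auto simp: nth_append)
  next
    fix i assume "\<forall>i<?n + ?m. x i \<in> (hs @ ks) ! i" "i < ?n"
    then show "x i \<in> hs ! i" by (metis nth_append trans_less_add1)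
  next
    fix i assume "\<forall>i<?n + ?m. x i \<in> (hs @ ks) ! i" "i < ?m"
    then show "x (?n + i) \<in> ks ! i" by (metis nth_append_length_plus nat_add_left_cancel_less)
  qed
  have C: "subspace h" "subspace k" "h \<subseteq> V" "k \<subseteq> V" "h \<inter> k = {0}"
    "\<And>v. v \<in> V \<Longrightarrow> \<exists>a\<in>h. \<exists>b\<in>k. v = a + b" using c by (auto simp: complementary_def)
  have hin: "(\<Sum>i<?n. x i) \<in> h" if "\<forall>i<?n. x i \<in> hs ! i" for x
    using hs that unfolding direct_sum_list_def by blast
  have kin: "(\<Sum>i<?m. x i) \<in> k" if "\<forall>i<?m. x i \<in> ks ! i" for x
    using ks that unfolding direct_sum_list_def by blast
  have h0: "\<forall>i<?n. x i = 0" if "\<forall>i<?n. x i \<in> hs ! i" "(\<Sum>i<?n. x i) = 0" for x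
    using hs that unfolding direct_sum_list_def by blast
  have k0: "\<forall>i<?m. x i = 0" if "\<forall>i<?m. x i \<in> ks ! i" "(\<Sum>i<?m. x i) = 0" for x
    using ks that unfolding direct_sum_list_def by blast
  show ?thesis
    unfolding direct_sum_list_def length_append split mem
  proof (intro conjI allI impI)
    show "\<forall>h\<in>set (hs @ ks). subspace h" using hs ks by (auto simp: direct_sum_list_def)
    show "V = {(\<Sum>i<?n. x i) + (\<Sum>i<?m. x (?n + i)) |x.
        (\<forall>i<?n. x i \<in> hs ! i) \<and> (\<forall>i<?m. x (?n + i) \<in> ks ! i)}" (is "_ = ?S")
    proof
      show "?S \<subseteq> V" using hin kin C(3,4) V by (auto intro!: subspace_add)
      show "V \<subseteq> ?S"
      proof
        fix v assume "v \<in> V"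
        then obtain a b where ab: "a \<in> h" "b \<in> k" "v = a + b" using C(6) by blast
        obtain y where y: "a = (\<Sum>i<?n. y i)" "\<forall>i<?n. y i \<in> hs ! i"
          using ab(1) hs unfolding direct_sum_list_def by blast
        obtain z where z: "b = (\<Sum>i<?m. z i)" "\<forall>i<?m. z i \<in> ks ! i"
          using ab(2) ks unfolding direct_sum_list_def by blast
        show "v \<in> ?S"
          by (intro CollectI exI[of _ "\<lambda>i. if i < ?n then y i else z (i - ?n)"]) (use y z ab in auto)
      qed
    qed
  next
    fix x i
    assume a: "((\<forall>i<?n. x i \<in> hs ! i) \<and> (\<forall>i<?m. x (?n + i) \<in> ks ! i)) \<and>
        (\<Sum>i<?n. x i) + (\<Sum>i<?m. x (?n + i)) = 0" and i: "i < ?n + ?m"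
    have "(\<Sum>i<?n. x i) = - (\<Sum>i<?m. x (?n + i))" using a by (simp add: add_eq_0_iff2)
    then have "(\<Sum>i<?n. x i) \<in> h \<inter> k" using a hin kin C(2) by (metis IntI subspace_neg)
    then have 0: "(\<Sum>i<?n. x i) = 0" "(\<Sum>i<?m. x (?n + i)) = 0" using C(5) a by auto
    have "\<forall>i<?n. x i = 0" using h0 0(1) a by blast
    moreover have "\<forall>i<?m. x (?n + i) = 0" using k0[of "\<lambda>i. x (?n + i)"] 0(2) a by blast
    ultimately show "x i = 0" using i by (metis add_less_cancel_left le_add_diff_inverse linorder_not_less)
  qed
qed

lemma direct_sum_list_complement:
  assumes V: "subspace V" and hs: "direct_sum_list V hs" and j: "j < length hs"
  shows "complementary V (hs ! j) (span (\<Union>i\<in>{..<length hs} - {j}. hs ! i))" (is "complementary V ?h ?k")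
proof -
  let ?n = "length hs"
  \<comment> \<open>\<open>S\<close> contains the span of the other summands, and each of its
    elements comes with a family whose \<open>j\<close>-th entry is zero, to which uniqueness of
    expansions applies.\<close>
  define S where "S = {(\<Sum>i<?n. x i) | x. (\<forall>i<?n. x i \<in> hs ! i) \<and> x j = 0}"
  have sub: "subspace (hs ! i)" if "i < ?n" for i using hs that by (auto simp: direct_sum_list_def)
  have Vin: "(\<Sum>i<?n. x i) \<in> V" if "\<forall>i<?n. x i \<in> hs ! i" for x
    using hs that unfolding direct_sum_list_def by blast
  have Vout: "\<exists>x. v = (\<Sum>i<?n. x i) \<and> (\<forall>i<?n. x i \<in> hs ! i)" if "v \<in> V" for v
    using hs that unfolding direct_sum_list_def by blast
  have zero: "\<forall>i<?n. x i = 0" if "\<forall>i<?n. x i \<in> hs ! i" "(\<Sum>i<?n. x i) = 0" for x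
    using hs that unfolding direct_sum_list_def by blast
  have single: "v = (\<Sum>i<?n. if i = l then v else 0)" if "l < ?n" for v l
    using that by simp
  have hV: "hs ! l \<subseteq> V" if "l < ?n" for l
  proof
    fix v assume "v \<in> hs ! l"
    then show "v \<in> V" using Vin[of "\<lambda>i. if i = l then v else 0"] that sub by (auto simp: subspace_0)
  qed
  have "subspace S"
  proof (rule subspaceI)
    show "0 \<in> S" unfolding S_def using sub by (intro CollectI exI[of _ "\<lambda>i. 0"]) (auto simp: subspace_0)
  next
    fix u v assume "u \<in> S" "v \<in> S"
    then obtain x y where "u = (\<Sum>i<?n. x i)" "\<forall>i<?n. x i \<in> hs ! i" "x j = 0"
      "v = (\<Sum>i<?n. y i)" "\<forall>i<?n. y i \<in> hs ! i" "y j = 0" unfolding S_def by blast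
    then show "u + v \<in> S" unfolding S_def using sub
      by (intro CollectI exI[of _ "\<lambda>i. x i + y i"]) (auto simp: sum.distrib subspace_add)
  next
    fix c u assume "u \<in> S"
    then obtain x where "u = (\<Sum>i<?n. x i)" "\<forall>i<?n. x i \<in> hs ! i" "x j = 0" unfolding S_def by blast
    then show "c *\<^sub>R u \<in> S" unfolding S_def using sub
      by (intro CollectI exI[of _ "\<lambda>i. c *\<^sub>R x i"]) (auto simp: scaleR_sum_right subspace_scale)
  qed
  moreover have "(\<Union>i\<in>{..<?n} - {j}. hs ! i) \<subseteq> S"
  proof
    fix v assume "v \<in> (\<Union>i\<in>{..<?n} - {j}. hs ! i)"
    then obtain l where "l < ?n" "l \<noteq> j" "v \<in> hs ! l" by blast
    then show "v \<in> S" unfolding S_def using single[of l v] sub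
      by (intro CollectI exI[of _ "\<lambda>i. if i = l then v else 0"]) (auto simp: subspace_0)
  qed
  ultimately have kS: "?k \<subseteq> S" by (simp add: span_minimal)
  have "v = 0" if v: "v \<in> ?h" "v \<in> S" for v
  proof -
    obtain x where x: "v = (\<Sum>i<?n. x i)" "\<forall>i<?n. x i \<in> hs ! i" "x j = 0" using v(2) unfolding S_def by blast
    \<comment> \<open>Subtracting \<open>v\<close> in slot \<open>j\<close> gives a family with sum
      zero; its \<open>j\<close>-th entry is \<open>- v\<close>.\<close>
    have "(\<Sum>i<?n. x i - (if i = j then v else 0)) = 0"
      using x(1) j by (simp add: sum_subtractf)
    then have "\<forall>i<?n. x i - (if i = j then v else 0) = 0"
      by (intro zero) (use x v sub in \<open>auto simp: subspace_neg\<close>)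
    then show ?thesis using j x(3) by auto
  qed
  then have "?h \<inter> ?k = {0}" using kS sub[OF j] by (auto simp: subspace_0 span_zero)
  moreover have "\<exists>a\<in>?h. \<exists>b\<in>?k. v = a + b" if vV: "v \<in> V" for v
  proof -
    obtain x where x: "v = (\<Sum>i<?n. x i)" "\<forall>i<?n. x i \<in> hs ! i" using Vout[OF vV] by blast
    then have "v = x j + (\<Sum>i\<in>{..<?n} - {j}. x i)" using j by (simp add: sum.remove)
    moreover have "(\<Sum>i\<in>{..<?n} - {j}. x i) \<in> ?k"
      using x(2) by (intro span_sum span_base) auto
    ultimately show ?thesis using x(2) j by blast
  qed
  moreover have "?k \<subseteq> V" using hV V by (intro span_minimal) auto
  ultimately show ?thesis using hV sub j by (auto simp: complementary_def)
qed

subsection \<open>Einstein metric Lie algebras\<close>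

lemma decomposableE:
  assumes "metric_lie V br ip" "decomposable V br ip"
  obtains h k where "complementary V h k" "strong_ideal V br ip h" "strong_ideal V br ip k"
    "nondegenerate_on h ip" "nondegenerate_on k ip" "h \<noteq> {0}" "k \<noteq> {0}"
  using assms(2) direct_sum_list_pair[OF metric_lie.sub[OF assms(1)]]
  unfolding decomposable_def by auto

text \<open>Induction on the dimension: a decomposable algebra splits into two proper summands,
  whose decompositions are concatenated.\<close>

lemma indecomposable_decomposition_exists:
  assumes "metric_lie V br ip"
  shows "\<exists>hs. indecomposable_decomposition V br ip hs"
  using assms
proof (induction "dim V" arbitrary: V rule: less_induct)
  case less
  interpret metric_lie V br ip by fact
  consider "V = {0}" | "V \<noteq> {0}" "\<not> decomposable V br ip" | "decomposable V br ip" by blast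
  then show ?case
  proof cases
    case 1
    \<comment> \<open>Summands must be non-zero, so the zero algebra is the empty sum.\<close>
    then have "indecomposable_decomposition V br ip []"
      by (auto simp: indecomposable_decomposition_def direct_sum_list_def)
    then show ?thesis ..
  next
    case 2
    have "strong_ideal V br ip V" using sub by (auto simp: strong_ideal_iff)
    moreover have "direct_sum_list V [V]"
      using sub by (auto simp: direct_sum_list_def intro: exI[of _ "\<lambda>i. _"])
    ultimately have "indecomposable_decomposition V br ip [V]"
      using 2 nondeg by (auto simp: indecomposable_decomposition_def)
    then show ?thesis ..
  next
    case 3
    then obtain h k where hk: "complementary V h k" "strong_ideal V br ip h" "strong_ideal V br ip k"
      "nondegenerate_on h ip" "nondegenerate_on k ip" "h \<noteq> {0}" "k \<noteq> {0}"
      using decomposableE[OF less.prems] by blast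
    have s: "subspace h" "subspace k" "h \<subseteq> V" "k \<subseteq> V" "h \<inter> k = {0}"
      using hk(1) by (auto simp: complementary_def)
    \<comment> \<open>If one summand were all of \<open>V\<close>, the other would equal the
      intersection, which is zero.\<close>
    then have "\<not> V \<subseteq> h" "\<not> V \<subseteq> k" using hk(6,7) by blast+
    with s have psub: "h \<subset> V" "k \<subset> V" by auto
    obtain B0 where B0: "finite B0" "span B0 = V" by (rule finite_span)
    obtain hs where hs: "indecomposable_decomposition h br ip hs"
      using less.hyps[OF dim_psubset[OF B0 s(1) psub(1)]] strong_ideal_metric_lie[OF hk(2,4)] by blast
    obtain ks where ks: "indecomposable_decomposition k br ip ks"
      using less.hyps[OF dim_psubset[OF B0 s(2) psub(2)]] strong_ideal_metric_lie[OF hk(3,5)] by blast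
    have "direct_sum_list V (hs @ ks)"
      using direct_sum_list_append[OF sub hk(1)] hs ks
      by (simp add: indecomposable_decomposition_def)
    moreover have "strong_ideal V br ip l" if "l \<in> set hs \<union> set ks" for l
      using that hs ks strong_ideal_trans[OF hk(1,2,4,3)]
        strong_ideal_trans[OF complementary_sym[OF hk(1)] hk(3,5,2)]
      by (auto simp: indecomposable_decomposition_def)
    ultimately have "indecomposable_decomposition V br ip (hs @ ks)"
      using hs ks by (auto simp: indecomposable_decomposition_def)
    then show ?thesis ..
  qed
qed

section \<open>Consequences of the Einstein equation with non-zero constant\<close>

locale einstein_lie = metric_lie +
  fixes c :: real
  assumes c: "c \<noteq> 0" and einstein: "einstein V br ip c"
begin

lemma right_annihilator_0:
  assumes x: "x \<in> V" "\<And>y. y \<in> V \<Longrightarrow> D y x = 0"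
  shows "x = 0"
proof (rule ip_eqI)
  fix y assume y: "y \<in> V"
  obtain B0 where B0: "finite B0" "span B0 = V" by (rule finite_span)
  have curv: "curvature V br ip z y x = 0" if "z \<in> V" for z
    using that x y by (simp add: curvature_def)
  \<comment> \<open>The curvature map vanishes on \<open>V\<close>, hence has values in the zero
    subspace, where the trace is a sum over the empty basis.\<close>
  have "trace_on {0} (\<lambda>z::'a. 0::'a) = 0"
    by (subst trace_on_eq[of "{}"]) (auto simp: linear_map_on_def real_vector.independent_empty)
  then have "ricci V br ip y x = 0"
    unfolding ricci_def
    using trace_on_subspace[OF B0, of "{0}" "\<lambda>z. curvature V br ip z y x" "\<lambda>z. 0"] curv
    by (simp add: linear_map_on_def)
  then have "ip y x = 0" using einstein x(1) y c by (auto simp: einstein_def)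
  then show "ip x y = ip 0 y" using ip_sym x(1) y by simp
qed (use x in auto)

text \<open>Otherwise some non-zero \<open>x\<close> is orthogonal to all products; by skewness
  every \<open>D y x\<close> is orthogonal to \<open>V\<close>, so \<open>x\<close> is annihilated
  from the left and must vanish.\<close>

lemma span_D: "span {D x y | x y. x \<in> V \<and> y \<in> V} = V" (is "?W = V")
proof (rule ccontr)
  assume "?W \<noteq> V"
  moreover have "?W \<subseteq> V" using sub by (intro span_minimal) auto
  ultimately have W: "?W \<subset> V" by auto
  obtain B0 where B0: "finite B0" "span B0 = V" by (rule finite_span)
  obtain x where x: "x \<in> V" "x \<noteq> 0" "\<And>w. w \<in> ?W \<Longrightarrow> ip x w = 0"
    using nondegenerate_orthogonal_vector[OF B0 ip_bilinear nondeg subspace_span W] by blast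
  have "D y x = 0" if "y \<in> V" for y
  proof (rule ip_eqI)
    fix z assume "z \<in> V"
    then have "ip x (D y z) = 0" using that by (intro x(3) span_base) blast
    then show "ip (D y x) z = ip 0 z" using D_skew[OF that x(1) \<open>z \<in> V\<close>] \<open>z \<in> V\<close> by simp
  qed (use that x in auto)
  then show False using right_annihilator_0[OF x(1)] x(2) by blast
qed

text \<open>\<open>span_D\<close> as an induction rule; membership of \<open>u\<close> in
  \<open>V\<close> is carried along for the bilinearity rules.\<close>

lemma D_induct [consumes 1, case_names zero step]:
  assumes "v \<in> V" "P 0" "\<And>a x y u. x \<in> V \<Longrightarrow> y \<in> V \<Longrightarrow> u \<in> V \<Longrightarrow> P u \<Longrightarrow> P (a *\<^sub>R D x y + u)"
  shows "P v"
proof -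
  have "v \<in> span {D x y | x y. x \<in> V \<and> y \<in> V}" using assms(1) span_D by simp
  then have "v \<in> V \<and> P v"
    by (induction rule: span_induct_alt) (use assms in auto)
  then show ?thesis by blast
qed

lemma complementary_D:
  assumes "complementary V h k" "strong_ideal V br ip h" "strong_ideal V br ip k"
    and "a \<in> h" "b \<in> k" "a' \<in> h" "b' \<in> k"
  shows "D (a + b) (a' + b') = D a a' + D b b'"
proof -
  have "h \<subseteq> V" "k \<subseteq> V" "h \<inter> k = {0}" using assms(1) by (auto simp: complementary_def)
  moreover from this have "D a b' = 0" "D b a' = 0"
    using complementary_D_0[OF _ assms(2,3)] assms by auto
  ultimately show ?thesis using assms by (simp add: subset_iff)
qed

text \<open>A product inside \<open>h\<close> is orthogonal to \<open>k\<close>, since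
  \<open>D a\<close> is skew and kills \<open>k\<close> for \<open>a\<close> in \<open>h\<close>. It
  remains to write \<open>x\<close> with such products only.\<close>

lemma complementary_orthogonal:
  assumes hk: "complementary V h k" "strong_ideal V br ip h" "strong_ideal V br ip k"
    and xy: "x \<in> h" "y \<in> k"
  shows "ip x y = 0"
proof -
  have s: "subspace h" "subspace k" "h \<subseteq> V" "k \<subseteq> V" "h \<inter> k = {0}"
    "\<And>v. v \<in> V \<Longrightarrow> \<exists>a\<in>h. \<exists>b\<in>k. v = a + b" using hk(1) by (auto simp: complementary_def)
  have Dh: "D a a' \<in> h" if "a \<in> h" "a' \<in> h" for a a'
    using hk(2) that s(3) by (auto simp: strong_ideal_iff)
  have Dk: "D a a' \<in> k" if "a \<in> k" "a' \<in> k" for a a'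
    using hk(3) that s(4) by (auto simp: strong_ideal_iff)
  have perp: "ip (D a a') z = 0" if "a \<in> h" "a' \<in> h" "z \<in> k" for a a' z
    using that s complementary_D_0(1)[OF s(5) hk(2,3), of a z] D_skew[of a a' z] by (simp add: subset_iff)
  have "x \<in> V" using xy s by auto
  \<comment> \<open>Stated so that the induction can run over all of \<open>V\<close>; for
    \<open>x\<close> in \<open>h\<close> the part \<open>b\<close> is zero.\<close>
  then have "\<exists>a\<in>h. \<exists>b\<in>k. x = a + b \<and> (\<forall>z\<in>k. ip a z = 0)"
  proof (induction rule: D_induct)
    case zero
    then show ?case using s by (intro bexI[of _ 0]) (auto simp: subspace_0)
  next
    case (step t p q u)
    obtain p1 p2 q1 q2 where pq: "p1 \<in> h" "p2 \<in> k" "p = p1 + p2" "q1 \<in> h" "q2 \<in> k" "q = q1 + q2"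
      using s(6) step by metis
    obtain a b where ab: "a \<in> h" "b \<in> k" "u = a + b" "\<forall>z\<in>k. ip a z = 0" using step by blast
    have "t *\<^sub>R D p q + u = (t *\<^sub>R D p1 q1 + a) + (t *\<^sub>R D p2 q2 + b)"
      using complementary_D[OF hk] pq ab by (simp add: scaleR_add_right)
    moreover have "ip (t *\<^sub>R D p1 q1 + a) z = 0" if "z \<in> k" for z
      using perp pq ab that s(3,4) by (simp add: subset_iff)
    moreover have "t *\<^sub>R D p1 q1 + a \<in> h" "t *\<^sub>R D p2 q2 + b \<in> k"
      using s pq ab Dh Dk by (simp_all add: subspace_add subspace_scale)
    ultimately show ?case by blast
  qed
  then obtain a b where ab: "a \<in> h" "b \<in> k" "x = a + b" "\<forall>z\<in>k. ip a z = 0" by blast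
  then have "b \<in> h" using xy(1) s(1) by (metis add_diff_cancel_left' subspace_diff)
  then have "b = 0" using ab(2) s(5) by auto
  then show ?thesis using ab xy by auto
qed

text \<open>Products span \<open>V\<close>, and the \<open>h\<close>-part of a product is a product
  inside \<open>h\<close>. Splitting its right factor along \<open>k\<close> and \<open>k'\<close>
  puts the two resulting products into \<open>h \<inter> k\<close> and
  \<open>h \<inter> k'\<close>.\<close>

lemma complementary_refine:
  assumes hl: "complementary V h l" "strong_ideal V br ip h" "strong_ideal V br ip l"
    and kk: "complementary V k k'" "strong_ideal V br ip k" "strong_ideal V br ip k'"
  shows "complementary h (h \<inter> k) (h \<inter> k')"
proof -
  have s: "subspace h" "subspace l" "h \<subseteq> V" "l \<subseteq> V" "h \<inter> l = {0}"
    "\<And>v. v \<in> V \<Longrightarrow> \<exists>a\<in>h. \<exists>b\<in>l. v = a + b" using hl(1) by (auto simp: complementary_def)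
  have t: "subspace k" "subspace k'" "k \<subseteq> V" "k' \<subseteq> V" "k \<inter> k' = {0}"
    "\<And>v. v \<in> V \<Longrightarrow> \<exists>a\<in>k. \<exists>b\<in>k'. v = a + b" using kk(1) by (auto simp: complementary_def)
  have Dl: "D a a' \<in> l" if "a \<in> l" "a' \<in> l" for a a'
    using hl(3) that s(4) by (auto simp: strong_ideal_iff)
  have Dk: "D a b \<in> h \<inter> k" if "a \<in> h" "b \<in> k" for a b
    using hl(2) kk(2) that s(3) t(3) unfolding strong_ideal_iff by blast
  have Dk': "D a b \<in> h \<inter> k'" if "a \<in> h" "b \<in> k'" for a b
    using hl(2) kk(3) that s(3) t(4) unfolding strong_ideal_iff by blast
  have "\<exists>a\<in>h \<inter> k. \<exists>b\<in>h \<inter> k'. x = a + b" if x: "x \<in> h" for x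
  proof -
    have "x \<in> V" using x s by auto
    \<comment> \<open>The term \<open>d\<close> absorbs the \<open>l\<close>-parts during the
      induction over \<open>V\<close> and vanishes once \<open>x\<close> is in
      \<open>h\<close>.\<close>
    then have "\<exists>a\<in>h \<inter> k. \<exists>b\<in>h \<inter> k'. \<exists>d\<in>l. x = a + b + d"
    proof (induction rule: D_induct)
      case zero
      then show ?case using s t by (intro bexI[of _ 0]) (auto simp: subspace_0)
    next
      case (step r p q u)
      obtain p1 p2 q1 q2 where pq: "p1 \<in> h" "p2 \<in> l" "p = p1 + p2" "q1 \<in> h" "q2 \<in> l" "q = q1 + q2"
        using s(6) step by metis
      \<comment> \<open>Membership of \<open>e\<close> and \<open>e'\<close> in \<open>h\<close> is
        not claimed; multiplying by \<open>p1\<close> from the left brings them into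
        \<open>h\<close>.\<close>
      obtain e e' where e: "e \<in> k" "e' \<in> k'" "q1 = e + e'" using t(6) pq(4) s(3) by blast
      obtain a b d where ab: "a \<in> h \<inter> k" "b \<in> h \<inter> k'" "d \<in> l" "u = a + b + d" using step by blast
      have "D p1 q1 = D p1 e + D p1 e'" using e pq s(3) t(3,4) by (simp add: subset_iff)
      then have "D p q = D p1 e + D p1 e' + D p2 q2"
        using complementary_D[OF hl] pq by simp
      then have "r *\<^sub>R D p q + u =
          (r *\<^sub>R D p1 e + a) + (r *\<^sub>R D p1 e' + b) + (r *\<^sub>R D p2 q2 + d)"
        using ab by (simp add: scaleR_add_right)
      moreover have "r *\<^sub>R D p1 e + a \<in> h \<inter> k" "r *\<^sub>R D p1 e' + b \<in> h \<inter> k'" "r *\<^sub>R D p2 q2 + d \<in> l"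
        using s t pq ab e Dk[of p1 e] Dk'[of p1 e'] Dl[of p2 q2]
        by (simp_all add: subspace_add subspace_scale)
      ultimately show ?case by blast
    qed
    then obtain a b d where ab: "a \<in> h \<inter> k" "b \<in> h \<inter> k'" "d \<in> l" "x = a + b + d" by blast
    then have "d = x - (a + b)" by simp
    moreover have "x - (a + b) \<in> h" using ab x s(1) by (intro subspace_diff subspace_add) auto
    ultimately have "d \<in> h" by simp
    then have "d = 0" using ab(3) s(5) by auto
    then show ?thesis using ab by auto
  qed
  moreover have "(h \<inter> k) \<inter> (h \<inter> k') = {0}" using t(5) s(1) by (auto simp: subspace_0)
  ultimately show ?thesis
    using s(1) t(1,2) by (simp add: complementary_def subspace_inter)
qed

text \<open>Otherwise both intersections in \<open>complementary_refine\<close> are non-zero, since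
  a zero one would put \<open>h\<close> inside the other ideal. They are non-degenerate because
  \<open>k\<close> and \<open>k'\<close> are orthogonal, so they decompose \<open>h\<close>.\<close>

lemma indecomposable_summand_subset:
  assumes hl: "complementary V h l" "strong_ideal V br ip h" "strong_ideal V br ip l"
    and h: "nondegenerate_on h ip" "\<not> decomposable h br ip"
    and kk: "complementary V k k'" "strong_ideal V br ip k" "strong_ideal V br ip k'"
  shows "h \<subseteq> k \<or> h \<subseteq> k'"
proof (rule ccontr)
  assume contr: "\<not> ?thesis"
  interpret h: metric_lie h br ip using strong_ideal_metric_lie hl(2) h(1) by blast
  have hV: "h \<subseteq> V" using hl by (auto simp: complementary_def)
  have c: "complementary h (h \<inter> k) (h \<inter> k')" by (rule complementary_refine[OF hl kk])
  have orth: "ip x y = 0" if "x \<in> k" "y \<in> k'" for x y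
    by (rule complementary_orthogonal[OF kk that])
  have split: "\<exists>a\<in>h \<inter> k. \<exists>b\<in>h \<inter> k'. x = a + b" if "x \<in> h" for x
    using c that by (auto simp: complementary_def)
  have "h \<inter> k \<noteq> {0}" "h \<inter> k' \<noteq> {0}"
    using split contr by (metis Int_iff add_0_left add_0_right singletonD subsetI)+
  moreover have "strong_ideal h br ip (h \<inter> m)" if "strong_ideal V br ip m" for m
  proof -
    have "strong_ideal V br ip (h \<inter> m)" using strong_ideal_inter hl(2) that by blast
    then show ?thesis
      using hV levi_civita_restrict[OF hl(2) h(1)] unfolding h.strong_ideal_iff strong_ideal_iff
      by (metis Int_iff Int_lower1 subsetD)
  qed
  moreover have "nondegenerate_on (h \<inter> k) ip"
    unfolding nondegenerate_on_def
  proof (intro ballI impI)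
    fix x assume x: "x \<in> h \<inter> k" "\<forall>y\<in>h \<inter> k. ip x y = 0"
    show "x = 0"
    proof (rule h.ip_eqI)
      fix z assume "z \<in> h"
      then obtain a b where "a \<in> h \<inter> k" "b \<in> h \<inter> k'" "z = a + b" using split by blast
      then show "ip x z = ip 0 z" using x orth[of x b] \<open>z \<in> h\<close> by simp
    qed (use x in auto)
  qed
  moreover have "nondegenerate_on (h \<inter> k') ip"
    unfolding nondegenerate_on_def
  proof (intro ballI impI)
    fix x assume x: "x \<in> h \<inter> k'" "\<forall>y\<in>h \<inter> k'. ip x y = 0"
    show "x = 0"
    proof (rule h.ip_eqI)
      fix z assume "z \<in> h"
      then obtain a b where "a \<in> h \<inter> k" "b \<in> h \<inter> k'" "z = a + b" using split by blast
      then show "ip x z = ip 0 z" using x orth[of a x] h.ip_sym[of x a] \<open>z \<in> h\<close> by simp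
    qed (use x in auto)
  qed
  ultimately have "decomposable h br ip"
    using kk c unfolding decomposable_def direct_sum_list_pair[OF h.sub, symmetric] by blast
  with h(2) show False by blast
qed

lemma einstein_summand:
  assumes hk: "complementary V h k" "strong_ideal V br ip h" "strong_ideal V br ip k"
    and nd: "nondegenerate_on h ip"
  shows "einstein h br ip c"
  unfolding einstein_def
proof (intro ballI)
  fix x y assume xy: "x \<in> h" "y \<in> h"
  interpret h: metric_lie h br ip using strong_ideal_metric_lie hk(2) nd by blast
  have s: "h \<subseteq> V" "k \<subseteq> V" "h \<inter> k = {0}"
    "\<And>v. v \<in> V \<Longrightarrow> \<exists>a\<in>h. \<exists>b\<in>k. v = a + b" using hk(1) by (auto simp: complementary_def)
  then have xyV: "x \<in> V" "y \<in> V" using xy by auto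
  have lin: "linear_map_on V (\<lambda>z. curvature V br ip z x y)"
    using xyV by (simp add: linear_map_on_def curvature_def Let_def scaleR_diff_right)
  have in_h: "curvature V br ip z x y \<in> h" if "z \<in> V" for z
    using that xy xyV hk(2) unfolding curvature_def Let_def strong_ideal_iff
    by (intro subspace_diff) auto
  \<comment> \<open>Agreement is asserted on \<open>h\<close> only, where the intrinsic connection
    is determined; \<open>trace_on_subspace\<close> asks for just this.\<close>
  have eq: "curvature h br ip z x y = curvature V br ip z x y" if "z \<in> h" for z
    using that xy levi_civita_restrict[OF hk(2) nd] h.D_in
    by (simp add: curvature_def Let_def levi_civita_restrict[OF hk(2) nd])
  obtain B0 where B0: "finite B0" "span B0 = V" by (rule finite_span)
  have "ricci V br ip x y = ricci h br ip x y"
    unfolding ricci_def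
    by (rule trace_on_subspace[OF B0 h.sub s(1) lin]) (use in_h eq in auto)
  then show "ricci h br ip x y = c * ip x y"
    using einstein xyV by (simp add: einstein_def)
qed

section \<open>Uniqueness of the indecomposable summands\<close>

context
  fixes hs
  assumes hs: "indecomposable_decomposition V br ip hs"
begin

text \<open>Presents an entry of the list as one half of a complementary pair of strong ideals, so
  that the two-summand results apply.\<close>

lemma summand:
  assumes "i < length hs"
  obtains k where "complementary V (hs ! i) k" "strong_ideal V br ip (hs ! i)" "strong_ideal V br ip k"
    "hs ! i \<noteq> {0}" "nondegenerate_on (hs ! i) ip" "\<not> decomposable (hs ! i) br ip"
    "\<And>j. j < length hs \<Longrightarrow> j \<noteq> i \<Longrightarrow> hs ! j \<subseteq> k"
proof
  let ?k = "span (\<Union>i\<in>{..<length hs} - {i}. hs ! i)"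
  have "direct_sum_list V hs" using hs by (simp add: indecomposable_decomposition_def)
  then show "complementary V (hs ! i) ?k"
    using direct_sum_list_complement[OF sub _ assms] by blast
  have all: "hs ! j \<noteq> {0} \<and> nondegenerate_on (hs ! j) ip \<and> strong_ideal V br ip (hs ! j) \<and>
      \<not> decomposable (hs ! j) br ip" if "j < length hs" for j
    using hs that by (simp add: indecomposable_decomposition_def)
  then show "strong_ideal V br ip (hs ! i)" "hs ! i \<noteq> {0}" "nondegenerate_on (hs ! i) ip"
    "\<not> decomposable (hs ! i) br ip"
    using assms by blast+
  show "strong_ideal V br ip ?k"
    using all by (intro strong_ideal_span_Union) auto
  show "hs ! j \<subseteq> ?k" if "j < length hs" "j \<noteq> i" for j
    using that by (auto intro: span_base)
qed

lemma summands_orthogonal: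
  assumes "i < length hs" "j < length hs" "i \<noteq> j" "x \<in> hs ! i" "y \<in> hs ! j"
  shows "ip x y = 0"
  using summand[OF assms(1)] complementary_orthogonal assms(2-) by (metis subsetD)

lemma einstein_summands: "h \<in> set hs \<Longrightarrow> einstein h br ip c"
  using summand einstein_summand by (metis in_set_conv_nth)

text \<open>For different indices \<open>hs ! i\<close> also lies in the complement of
  \<open>hs ! j\<close>, hence in zero.\<close>

lemma summand_subset_eq:
  assumes "i < length hs" "j < length hs" "hs ! i \<subseteq> hs ! j"
  shows "i = j"
proof (rule ccontr)
  assume "i \<noteq> j"
  obtain k where k: "complementary V (hs ! j) k" "\<And>l. l < length hs \<Longrightarrow> l \<noteq> j \<Longrightarrow> hs ! l \<subseteq> k"
    using summand[OF assms(2)] by metis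
  then have "hs ! i \<subseteq> {0}" using assms \<open>i \<noteq> j\<close> unfolding complementary_def by blast
  moreover have "hs ! i \<noteq> {0}" "0 \<in> hs ! i"
    using summand[OF assms(1)] by (metis, metis complementary_def subspace_0)
  ultimately show False by blast
qed

lemma distinct_summands: "distinct hs"
  using summand_subset_eq by (metis distinct_conv_nth order_refl)

lemma perp_summands_0:
  assumes "x \<in> V" "\<And>j y. j < length hs \<Longrightarrow> y \<in> hs ! j \<Longrightarrow> ip x y = 0"
  shows "x = 0"
proof (rule ip_eqI)
  fix z assume z: "z \<in> V"
  then obtain y where y: "z = (\<Sum>i<length hs. y i)" "\<forall>i<length hs. y i \<in> hs ! i"
    using hs unfolding indecomposable_decomposition_def direct_sum_list_def by blast
  have yV: "y i \<in> V" if "i < length hs" for i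
    using summand[OF that] y(2) that by (metis complementary_def subsetD)
  have "linear_map_on V (ip x)" using assms(1) by (simp add: linear_map_on_def)
  then have "ip x z = (\<Sum>i<length hs. ip x (y i))"
    using linear_map_on_sum[OF sub, of "ip x" "{..<length hs}" y "\<lambda>_. 1"] yV y(1) by simp
  then show "ip x z = ip 0 z" using assms(2) y(2) z by simp
qed (use assms in auto)

text \<open>If \<open>h\<close> lies in no summand, the dichotomy puts it into the complement of
  each one. Then \<open>h\<close> is orthogonal to every summand and therefore zero.\<close>

lemma indecomposable_subset_summand:
  assumes hl: "complementary V h l" "strong_ideal V br ip h" "strong_ideal V br ip l"
    and h: "nondegenerate_on h ip" "\<not> decomposable h br ip" "h \<noteq> {0}"
  shows "\<exists>i<length hs. h \<subseteq> hs ! i"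
proof (rule ccontr)
  assume none: "\<not> ?thesis"
  have s: "subspace h" "h \<subseteq> V" using hl(1) by (auto simp: complementary_def)
  have "ip x y = 0" if x: "x \<in> h" and j: "j < length hs" and y: "y \<in> hs ! j" for x y j
  proof -
    obtain k where k: "complementary V (hs ! j) k" "strong_ideal V br ip (hs ! j)" "strong_ideal V br ip k"
      by (rule summand[OF j])
    have "h \<subseteq> k" using indecomposable_summand_subset[OF hl h(1,2) k] none j by blast
    then show ?thesis
      using complementary_orthogonal[OF complementary_sym[OF k(1)] k(3,2)] x y by blast
  qed
  then have "h \<subseteq> {0}" using perp_summands_0 s by blast
  then show False using h(3) s(1) subspace_0 by blast
qed

end

text \<open>A summand lies in one of the other list, which lies in one of the first list; by
  \<open>summand_subset_eq\<close> the chain returns to its start, so all inclusions are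
  equalities.\<close>

lemma set_indecomposable_decomposition_subset:
  assumes hs: "indecomposable_decomposition V br ip hs" and ks: "indecomposable_decomposition V br ip ks"
  shows "set hs \<subseteq> set ks"
proof
  fix h assume "h \<in> set hs"
  then obtain i where i: "i < length hs" "h = hs ! i" by (metis in_set_conv_nth)
  have "\<exists>j<length ks. hs ! i \<subseteq> ks ! j"
    by (rule summand[OF hs i(1)]) (blast intro: indecomposable_subset_summand[OF ks])
  then obtain j where j: "j < length ks" "hs ! i \<subseteq> ks ! j" by blast
  have "\<exists>l<length hs. ks ! j \<subseteq> hs ! l"
    by (rule summand[OF ks j(1)]) (blast intro: indecomposable_subset_summand[OF hs])
  then obtain l where l: "l < length hs" "ks ! j \<subseteq> hs ! l" by blast
  have "i = l" using summand_subset_eq[OF hs i(1) l(1)] j(2) l(2) by blast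
  then have "h = ks ! j" using i j l by blast
  then show "h \<in> set ks" using j by simp
qed

text \<open>Lists without repetition that have the same set of entries are equal as
  multisets.\<close>

lemma indecomposable_decomposition_unique:
  assumes "indecomposable_decomposition V br ip hs" "indecomposable_decomposition V br ip ks"
  shows "mset hs = mset ks"
  using set_indecomposable_decomposition_subset distinct_summands assms
  by (metis set_eq_iff_mset_eq_distinct subset_antisym)

end

theorem corollary4p3:
  fixes \<gg> :: "'a::real_vector set"
    and br :: "'a \<Rightarrow> 'a \<Rightarrow> 'a"
    and ip :: "'a \<Rightarrow> 'a \<Rightarrow> real"
    and c :: real
  assumes "metric_lie_algebra \<gg> br ip"
    and "c \<noteq> 0"
    and "einstein \<gg> br ip c"
  shows "(\<exists>hs. indecomposable_decomposition \<gg> br ip hs) \<and>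
    (\<forall>hs. indecomposable_decomposition \<gg> br ip hs \<longrightarrow>
       (\<forall>i<length hs. \<forall>j<length hs. i \<noteq> j \<longrightarrow> (\<forall>x\<in>hs ! i. \<forall>y\<in>hs ! j. ip x y = 0)) \<and>
       (\<forall>h\<in>set hs. einstein h br ip c)) \<and>
    (\<forall>hs hs'. indecomposable_decomposition \<gg> br ip hs \<and>
       indecomposable_decomposition \<gg> br ip hs' \<longrightarrow> mset hs = mset hs')"
proof -
  interpret einstein_lie \<gg> br ip c by standard (use assms in auto)
  show ?thesis
    using indecomposable_decomposition_exists[OF metric_lie_axioms] summands_orthogonal
      einstein_summands indecomposable_decomposition_unique
    by blast
qed

end
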